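(* Let $n$ and $k$ be integers with $3\le k< n/2$ and \[ n\ge\begin{cases} 8, & k=3,\\ 10, & k=4,\\ \frac{k(k+1)}{2}, & k \text{ odd and } k\ge 5,\\ \frac{k^2}{2}, & k \text{ even and } k\ge 6. \end{cases} \] Then the generalized Petersen graph $GP(n,k)$ is ${\rm diam}(GP(n,k))$-distance-balanced.
   Context: For $n\ge 3$ and $1\le k<n/2$, the generalized Petersen graph $GP(n,k)$ has vertex set $\{u_i: i\in\mathbb{Z}_n\}\cup\{v_i: i\in\mathbb{Z}_n\}$ and edge set $\{u_iu_{i+1}: i\in\mathbb{Z}_n\}\cup\{v_iv_{i+k}: i\in\mathbb{Z}_n\}\cup\{u_iv_i: i\in\mathbb{Z}_n\}$ (indices mod $n$). For a connected graph $G$, $d_G(x,y)$ is the shortest-path distance and ${\rm diam}(G)$ is the maximum distance. For $x,y\in V(G)$, $W_{xy}=\{w\in V(G): d_G(w,x)<d_G(w,y)\}$. For an integer $\ell$ with $1\le \ell\le {\rm diam}(G)$, $G$ is called $\ell$-distance-balanced if $|W_{xy}|=|W_{yx}|$ for every pair $x,y\in V(G)$ with $d_G(x,y)=\ell$. *)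

theory Defs
  imports
    Complex_Main
    "Graph_Theory.Pair_Digraph"
    "Graph_Theory.Digraph_Component"
    "Graph_Theory.Shortest_Path"
begin

definition gdist :: "('a, 'b) pre_digraph \<Rightarrow> 'a \<Rightarrow> 'a \<Rightarrow> nat" where
  "gdist G x y = (INF p \<in> {p. pre_digraph.awalk G x p y}. length p)"

(* gdist is the library's shortest-path length for unit weights, valued in nat. The
   hypothesis excludes disconnected pairs, where the infimum over the empty set of
   naturals is 0. *)
lemma (in wf_digraph) ereal_gdist:
  assumes "x \<rightarrow>\<^sup>*\<^bsub>G\<^esub> y"
  shows "\<mu> (\<lambda>_. 1) x y = ereal (real (gdist G x y))"
proof -
  let ?P = "{p. awalk x p y}"
  have cost: "awalk_cost (\<lambda>_. 1) p = real (length p)" for p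
    by (induct p) auto
  have ne: "?P \<noteq> {}"
    using assms by (simp add: reachable_awalk)
  then have "gdist G x y \<in> length ` ?P"
    unfolding gdist_def by (intro Inf_nat_def1) simp
  then obtain p where p: "awalk x p y" "length p = gdist G x y"
    by auto
  have le: "gdist G x y \<le> length q" if "awalk x q y" for q
    unfolding gdist_def using that by (intro cINF_lower) auto
  show ?thesis
    unfolding \<mu>_def cost
  proof (rule antisym)
    show "(INF q\<in>?P. ereal (real (length q))) \<le> ereal (real (gdist G x y))"
      using p by (intro INF_lower2[of p]) auto
    show "ereal (real (gdist G x y)) \<le> (INF q\<in>?P. ereal (real (length q)))"
      using le by (intro INF_greatest) auto
  qed
qed

definition diam :: "('a, 'b) pre_digraph \<Rightarrow> nat" where
  "diam G = Max {gdist G x y | x y. x \<in> verts G \<and> y \<in> verts G}"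

definition W :: "('a, 'b) pre_digraph \<Rightarrow> 'a \<Rightarrow> 'a \<Rightarrow> 'a set" where
  "W G x y = {w \<in> verts G. gdist G w x < gdist G w y}"

(* The notion is only defined for connected graphs and 1 <= l <= diam G; these
   requirements are made part of the predicate. The theory qualifier distinguishes graph
   connectedness from the topological one. *)
definition distance_balanced :: "nat \<Rightarrow> ('a, 'b) pre_digraph \<Rightarrow> bool" where
  "distance_balanced l G \<longleftrightarrow>
     Digraph_Component.connected G \<and> 1 \<le> l \<and> l \<le> diam G \<and>
     (\<forall>x \<in> verts G. \<forall>y \<in> verts G. gdist G x y = l \<longrightarrow> card (W G x y) = card (W G y x))"

datatype gp_vertex = U int | V int

definition GP_edges :: "int \<Rightarrow> int \<Rightarrow> gp_vertex rel" where
  "GP_edges n k =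
     {(U i, U ((i + 1) mod n)) | i. i \<in> {0..<n}} \<union>
     {(V i, V ((i + k) mod n)) | i. i \<in> {0..<n}} \<union>
     {(U i, V i) | i. i \<in> {0..<n}}"

(* Residues mod n are represented by 0, ..., n-1, and each undirected edge by a pair of
   opposite arcs. *)
definition GP :: "int \<Rightarrow> int \<Rightarrow> gp_vertex pair_pre_digraph" where
  "GP n k = \<lparr> pverts = U ` {0..<n} \<union> V ` {0..<n},
              parcs = GP_edges n k \<union> (GP_edges n k)\<inverse> \<rparr>"

lemma pair_graph_GP:
  fixes n k :: int
  assumes "n \<ge> 3" "1 \<le> k" "2 * k < n"
  shows "pair_graph (GP n k)"
proof -
  have shift: "(i + j) mod n \<noteq> i" if "0 \<le> i" "i < n" "0 < j" "j < n" for i j :: int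
  proof
    assume "(i + j) mod n = i"
    then have "n dvd i + j - i"
      using mod_eq_dvd_iff[of "i + j" n i] that by simp
    then show False
      using that zdvd_not_zless[of j n] by simp
  qed
  have sub: "GP_edges n k \<subseteq> pverts (GP n k) \<times> pverts (GP n k)"
    using assms by (auto simp: GP_edges_def GP_def)
  have loopfree: "(x, x) \<notin> GP_edges n k" for x
    using assms shift[of _ 1] shift[of _ k] by (force simp: GP_edges_def)
  have fin: "finite (pverts (GP n k))"
    by (simp add: GP_def)
  have arcs: "parcs (GP n k) = GP_edges n k \<union> (GP_edges n k)\<inverse>"
    by (simp add: GP_def)
  have arcs_sub: "parcs (GP n k) \<subseteq> pverts (GP n k) \<times> pverts (GP n k)"
    using sub unfolding arcs by auto
  show ?thesis
  proof unfold_locales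
    show "finite (pverts (GP n k))"
      by (rule fin)
    show "finite (parcs (GP n k))"
      using finite_subset[OF arcs_sub] fin by simp
    show "symmetric (with_proj (GP n k))"
      by (auto simp: symmetric_def arcs sym_def)
  qed (use arcs_sub loopfree arcs in \<open>force+\<close>)
qed

end

theory Submission
  imports Defs
begin

text \<open>
  The reflection \<open>t \<mapsto> i + j - t\<close> of the indices is an automorphism, so it swaps \<open>u\<^sub>i\<close> with \<open>u\<^sub>j\<close>
  and \<open>v\<^sub>i\<close> with \<open>v\<^sub>j\<close>; such pairs are always balanced, and it suffices that no pair \<open>u\<^sub>i\<close>, \<open>v\<^sub>j\<close>
  is diametral. Let \<open>|j|\<close> be the word norm of \<open>j\<close> in the residues modulo \<open>n\<close> for the generators \<open>1\<close>
  and \<open>k\<close>, with maximum \<open>m\<close>. The distance from \<open>u\<^sub>i\<close> to \<open>v\<^sub>j\<close> is at most \<open>|j - i| + 1 \<le> m + 1\<close>. A walk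
  from \<open>u\<^sub>0\<close> to \<open>u\<^sub>j\<close> either stays on the outer cycle or uses two spokes, so it has length at least
  \<open>m + 2\<close> if \<open>|j| = m\<close> and \<open>j\<close> is far from \<open>0\<close> on the outer cycle. A counting argument gives such
  a \<open>j\<close>, whence the diameter is at least \<open>m + 2\<close>.
\<close>

section \<open>Distances and powers of the arc relation\<close>

text \<open>Relational powers make walks easy to concatenate, reverse and map. The vertex condition
  matters at \<open>l = 0\<close>, where the power is the identity also outside the graph.\<close>

lemma (in pair_wf_digraph) awalk_iff_relpow:
  "(\<exists>p. awalk x p y \<and> length p = l) \<longleftrightarrow> x \<in> pverts G \<and> (x, y) \<in> parcs G ^^ l"
proof (induction l arbitrary: x)
  case 0
  show ?case by (auto simp: awalk_Nil_iff)
next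
  case (Suc l)
  have "(\<exists>p. awalk x p y \<and> length p = Suc l) \<longleftrightarrow>
      (\<exists>z. (x, z) \<in> parcs G \<and> (\<exists>p. awalk z p y \<and> length p = l))"
    (is "?L \<longleftrightarrow> ?R")
  proof
    assume ?L
    then obtain e p where "awalk x (e # p) y" "length p = l"
      by (auto simp: length_Suc_conv)
    then show ?R
      by (intro exI[of _ "snd e"]) (auto simp: awalk_Cons_iff)
  next
    assume ?R
    then obtain z p where "(x, z) \<in> parcs G" "awalk z p y" "length p = l" by blast
    then have "awalk x ((x, z) # p) y" "length ((x, z) # p) = Suc l"
      by (auto simp: awalk_Cons_iff)
    then show ?L by blast
  qed
  also have "\<dots> \<longleftrightarrow> (\<exists>z. (x, z) \<in> parcs G \<and> (z, y) \<in> parcs G ^^ l)"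
    using Suc.IH in_arcsD2 by blast
  also have "\<dots> \<longleftrightarrow> x \<in> pverts G \<and> (x, y) \<in> parcs G ^^ Suc l"
    using in_arcsD1 by (blast intro: relpow_Suc_I2 elim: relpow_Suc_E2)
  finally show ?case .
qed

lemma (in pair_wf_digraph) gdist_eq_Inf_relpow:
  assumes "x \<in> pverts G"
  shows "gdist (with_proj G) x y = Inf {l. (x, y) \<in> parcs G ^^ l}"
proof -
  have "length ` {p. awalk x p y} = {l. \<exists>p. awalk x p y \<and> length p = l}"
    by auto
  then show ?thesis
    using assms by (simp add: gdist_def awalk_iff_relpow)
qed

lemma (in pair_wf_digraph) gdist_le_relpow:
  assumes "(x, y) \<in> parcs G ^^ l" "x \<in> pverts G"
  shows "gdist (with_proj G) x y \<le> l"
  using assms by (simp add: gdist_eq_Inf_relpow cInf_lower)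

lemma (in pair_wf_digraph) relpow_gdist:
  assumes "(x, y) \<in> parcs G ^^ l" "x \<in> pverts G"
  shows "(x, y) \<in> parcs G ^^ gdist (with_proj G) x y"
proof -
  have "Inf {l. (x, y) \<in> parcs G ^^ l} \<in> {l. (x, y) \<in> parcs G ^^ l}"
    using assms by (intro Inf_nat_def1) auto
  then show ?thesis using assms by (simp add: gdist_eq_Inf_relpow)
qed

lemma relpow_map:
  assumes "\<And>x y. (x, y) \<in> R \<Longrightarrow> (f x, f y) \<in> S" "(x, y) \<in> R ^^ l"
  shows "(f x, f y) \<in> S ^^ l"
  using assms(2) by (induction l arbitrary: y) (auto intro: assms(1))

text \<open>An involution that preserves arcs is an automorphism and hence an isometry. As it
  exchanges \<open>x\<close> and \<open>y\<close>, it maps each of the two sets bijectively onto the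
  other.\<close>

lemma (in pair_wf_digraph) card_W_swap:
  assumes f: "\<And>x. x \<in> pverts G \<Longrightarrow> f x \<in> pverts G" "\<And>x. x \<in> pverts G \<Longrightarrow> f (f x) = x"
    and arcs: "\<And>x y. (x, y) \<in> parcs G \<Longrightarrow> (f x, f y) \<in> parcs G"
    and xy: "x \<in> pverts G" "f x = y"
  shows "card (W (with_proj G) x y) = card (W (with_proj G) y x)"
proof -
  have fy: "f y = x" "y \<in> pverts G" using f xy by auto
  have d: "gdist (with_proj G) (f a) (f b) = gdist (with_proj G) a b"
    if "a \<in> pverts G" "b \<in> pverts G" for a b
  proof -
    \<comment> \<open>The converse direction applies \<open>f\<close> once more, since
      \<open>f (f a) = a\<close>.\<close>
    have "(f a, f b) \<in> parcs G ^^ l \<longleftrightarrow> (a, b) \<in> parcs G ^^ l" for l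
      using relpow_map[of "parcs G" f "parcs G", OF arcs] f(2) that by metis
    then show ?thesis using that f by (simp add: gdist_eq_Inf_relpow)
  qed
  have "bij_betw f (W (with_proj G) x y) (W (with_proj G) y x)"
  proof (rule bij_betw_byWitness[where f' = f])
    show "f ` W (with_proj G) x y \<subseteq> W (with_proj G) y x"
      using f fy xy d[of _ x] d[of _ y] by (auto simp: W_def)
    show "f ` W (with_proj G) y x \<subseteq> W (with_proj G) x y"
      using f fy xy d[of _ x] d[of _ y] by (auto simp: W_def)
  qed (auto simp: W_def f)
  then show ?thesis by (rule bij_betw_same_card)
qed

section \<open>Lattice points in a diamond\<close>

text \<open>The sphere of radius \<open>r + 1\<close> has four sides of \<open>r + 1\<close> points
  each, and 1 + 4(1 + ... + r) = 2r(r + 1) + 1.\<close>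

lemma card_diamond_le:
  "finite {(a::int, b::int). \<bar>a\<bar> + \<bar>b\<bar> \<le> int r} \<and>
   card {(a::int, b::int). \<bar>a\<bar> + \<bar>b\<bar> \<le> int r} \<le> 2 * r * (r + 1) + 1"
proof (induction r)
  case 0
  have "{(a::int, b::int). \<bar>a\<bar> + \<bar>b\<bar> \<le> int 0} = {(0, 0)}" by auto
  then show ?case by simp
next
  case (Suc r)
  let ?D = "\<lambda>r. {(a::int, b::int). \<bar>a\<bar> + \<bar>b\<bar> \<le> int r}"
  let ?T = "{0..<int r + 1}" and ?s = "int r + 1"
  \<comment> \<open>Each side is half-open: it contains the corner at \<open>t = 0\<close> and
    leaves the next corner to its neighbour.\<close>
  define A where "A = (\<lambda>t. (t, ?s - t)) ` ?T"
  define B where "B = (\<lambda>t. (?s - t, - t)) ` ?T"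
  define C where "C = (\<lambda>t. (- t, t - ?s)) ` ?T"
  define D where "D = (\<lambda>t. (t - ?s, t)) ` ?T"
  have sub: "?D (Suc r) \<subseteq> ?D r \<union> (A \<union> B \<union> (C \<union> D))"
  proof safe
    fix a b :: int
    assume *: "\<bar>a\<bar> + \<bar>b\<bar> \<le> int (Suc r)" "(a, b) \<notin> D" "(a, b) \<notin> C" "(a, b) \<notin> B" "(a, b) \<notin> A"
    have "(a, b) \<in> A" if "b = ?s - a" "0 \<le> a" "a < ?s" using that by (auto simp: A_def)
    moreover have "(a, b) \<in> B" if "a = ?s + b" "0 \<le> - b" "- b < ?s"
      using that by (auto simp: B_def intro!: image_eqI[of _ _ "- b"])
    moreover have "(a, b) \<in> C" if "b = - a - ?s" "0 \<le> - a" "- a < ?s"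
      using that by (auto simp: C_def intro!: image_eqI[of _ _ "- a"])
    moreover have "(a, b) \<in> D" if "a = b - ?s" "0 \<le> b" "b < ?s" using that by (auto simp: D_def)
    ultimately show "\<bar>a\<bar> + \<bar>b\<bar> \<le> int r" using * by linarith
  qed
  have c: "card A \<le> r + 1" "card B \<le> r + 1" "card C \<le> r + 1" "card D \<le> r + 1"
    unfolding A_def B_def C_def D_def by (rule order_trans[OF card_image_le]; simp)+
  have fin: "finite (?D r \<union> (A \<union> B \<union> (C \<union> D)))"
    using Suc.IH by (auto simp: A_def B_def C_def D_def)
  have "card (?D (Suc r)) \<le> card (?D r \<union> (A \<union> B \<union> (C \<union> D)))"
    by (rule card_mono[OF fin sub])
  also have "\<dots> \<le> card (?D r) + ((card A + card B) + (card C + card D))"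
    by (intro order_trans[OF card_Un_le] add_mono order_refl)
  also have "\<dots> \<le> 2 * Suc r * (Suc r + 1) + 1"
    using Suc.IH c by simp
  finally show ?case using finite_subset[OF sub fin] by blast
qed

section \<open>Generalized Petersen graphs\<close>

locale generalized_petersen =
  fixes n k :: int
  assumes k_ge: "3 \<le> k" and n_gt: "2 * k < n"
begin

sublocale pair_graph "GP n k"
  using k_ge n_gt by (intro pair_graph_GP) auto

section \<open>Vertices and arcs indexed by all integers\<close>

abbreviation E :: "gp_vertex rel" where "E \<equiv> parcs (GP n k)"

text \<open>Reducing inside the constructor lets index arithmetic take place in the integers; only
  equality of vertices involves \<open>n\<close>.\<close>

definition u :: "int \<Rightarrow> gp_vertex" where "u i = U (i mod n)"
definition v :: "int \<Rightarrow> gp_vertex" where "v i = V (i mod n)"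

lemma u_eq_iff: "u i = u j \<longleftrightarrow> n dvd i - j"
  and v_eq_iff: "v i = v j \<longleftrightarrow> n dvd i - j"
  and u_neq_v: "u i \<noteq> v j" "v j \<noteq> u i"
  by (auto simp: u_def v_def mod_eq_dvd_iff)

lemma pverts_GP: "pverts (GP n k) = range u \<union> range v"
proof -
  have "range (\<lambda>i. i mod n) = {0..<n}"
  proof
    show "{0..<n} \<subseteq> range (\<lambda>i. i mod n)"
      by (auto intro!: image_eqI[of _ "\<lambda>i. i mod n", OF mod_pos_pos_trivial[symmetric]])
  qed (use k_ge n_gt in auto)
  then have "range u = U ` {0..<n}" "range v = V ` {0..<n}"
    unfolding u_def v_def by (metis image_image)+
  then show ?thesis by (simp add: GP_def)
qed

lemma u_in_pverts [simp]: "u i \<in> pverts (GP n k)"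
  and v_in_pverts [simp]: "v i \<in> pverts (GP n k)"
  by (auto simp: pverts_GP)

lemma GP_edges_eq:
  "GP_edges n k = range (\<lambda>i. (u i, u (i + 1))) \<union> range (\<lambda>i. (v i, v (i + k))) \<union> range (\<lambda>i. (u i, v i))"
    (is "_ = ?R")
proof
  show "GP_edges n k \<subseteq> ?R"
  proof
    fix e assume "e \<in> GP_edges n k"
    then obtain i where "i \<in> {0..<n}"
      "e = (U i, U ((i + 1) mod n)) \<or> e = (V i, V ((i + k) mod n)) \<or> e = (U i, V i)"
      by (auto simp: GP_edges_def)
    then have "e = (u i, u (i + 1)) \<or> e = (v i, v (i + k)) \<or> e = (u i, v i)"
      by (simp add: u_def v_def)
    then show "e \<in> ?R" by blast
  qed
  have "(u i, u (i + 1)) \<in> GP_edges n k \<and> (v i, v (i + k)) \<in> GP_edges n k \<and> (u i, v i) \<in> GP_edges n k"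
    for i
  proof -
    have "i mod n \<in> {0..<n}" using k_ge n_gt by simp
    moreover have "u i = U (i mod n)" "v i = V (i mod n)"
      "u (i + 1) = U ((i mod n + 1) mod n)" "v (i + k) = V ((i mod n + k) mod n)"
      by (simp_all add: u_def v_def mod_add_left_eq)
    ultimately show ?thesis unfolding GP_edges_def by blast
  qed
  then show "?R \<subseteq> GP_edges n k" by blast
qed

lemma sym_E: "sym E"
  by (auto simp: GP_def sym_def)

lemma arc_u_iff: "(u i, x) \<in> E \<longleftrightarrow> x = u (i + 1) \<or> x = u (i - 1) \<or> x = v i"
proof -
  have "(\<exists>j. u i = u j \<and> x = u (j + 1)) \<longleftrightarrow> x = u (i + 1)"
    "(\<exists>j. u i = u j \<and> x = v j) \<longleftrightarrow> x = v i"
    by (auto simp: u_eq_iff v_eq_iff dvd_diff_commute intro: exI[of _ i])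
  moreover have "(\<exists>j. u i = u (j + 1) \<and> x = u j) \<longleftrightarrow> x = u (i - 1)"
  proof
    assume "\<exists>j. u i = u (j + 1) \<and> x = u j"
    then show "x = u (i - 1)" by (auto simp: u_eq_iff algebra_simps)
  qed (auto intro!: exI[of _ "i - 1"])
  ultimately show ?thesis
    by (auto simp: GP_def GP_edges_eq u_neq_v)
qed

lemma arc_v_iff: "(v i, x) \<in> E \<longleftrightarrow> x = v (i + k) \<or> x = v (i - k) \<or> x = u i"
proof -
  have "(\<exists>j. v i = v j \<and> x = v (j + k)) \<longleftrightarrow> x = v (i + k)"
    "(\<exists>j. v i = v j \<and> x = u j) \<longleftrightarrow> x = u i"
    by (auto simp: u_eq_iff v_eq_iff dvd_diff_commute intro: exI[of _ i])
  moreover have "(\<exists>j. v i = v (j + k) \<and> x = v j) \<longleftrightarrow> x = v (i - k)"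
  proof
    assume "\<exists>j. v i = v (j + k) \<and> x = v j"
    then show "x = v (i - k)" by (auto simp: v_eq_iff algebra_simps)
  qed (auto intro!: exI[of _ "i - k"])
  ultimately show ?thesis
    by (auto simp: GP_def GP_edges_eq u_neq_v)
qed

section \<open>Walks and connectedness\<close>

lemma u_walk: "(u i, u (i + a)) \<in> E ^^ nat \<bar>a\<bar>"
proof -
  have "(u i, u (i + int m)) \<in> E ^^ m" "(u i, u (i - int m)) \<in> E ^^ m" for m
  proof (induction m)
    case (Suc m)
    {
      case 1
      show ?case using Suc(1) by (auto intro!: relcompI[OF Suc(1)] simp: arc_u_iff algebra_simps)
    next
      case 2
      show ?case using Suc(2) by (auto intro!: relcompI[OF Suc(2)] simp: arc_u_iff algebra_simps)
    }
  qed auto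
  from this[of "nat \<bar>a\<bar>"] show ?thesis by (cases "a \<ge> 0") auto
qed

lemma v_walk: "(v i, v (i + b * k)) \<in> E ^^ nat \<bar>b\<bar>"
proof -
  have "(v i, v (i + int m * k)) \<in> E ^^ m" "(v i, v (i - int m * k)) \<in> E ^^ m" for m
  proof (induction m)
    case (Suc m)
    {
      case 1
      show ?case using Suc(1) by (auto intro!: relcompI[OF Suc(1)] simp: arc_v_iff algebra_simps)
    next
      case 2
      show ?case using Suc(2) by (auto intro!: relcompI[OF Suc(2)] simp: arc_v_iff algebra_simps)
    }
  qed auto
  from this[of "nat \<bar>b\<bar>"] show ?thesis by (cases "b \<ge> 0") auto
qed

text \<open>Walk \<open>a\<close> along the outer cycle, cross one spoke, which accounts for the
  \<open>+ 1\<close>, then make \<open>b\<close> inner steps.\<close>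

lemma u_v_walk: "(u i, v (i + a + b * k)) \<in> E ^^ (nat (\<bar>a\<bar> + \<bar>b\<bar>) + 1)"
proof -
  have "(u i, v (i + a)) \<in> E ^^ Suc (nat \<bar>a\<bar>)"
    using u_walk[of i a] by (auto simp: arc_u_iff)
  then have "(u i, v (i + a + b * k)) \<in> E ^^ (Suc (nat \<bar>a\<bar>) + nat \<bar>b\<bar>)"
    using v_walk[of "i + a" b] unfolding relpow_add by blast
  then show ?thesis by (simp add: nat_add_distrib)
qed

lemma relpow_sym: "(x, y) \<in> E ^^ l \<Longrightarrow> (y, x) \<in> E ^^ l"
proof (induction l arbitrary: y)
  case (Suc l)
  then obtain z where "(x, z) \<in> E ^^ l" "(z, y) \<in> E" by auto
  then show ?case using Suc.IH symD[OF sym_E] by (blast intro: relpow_Suc_I2)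
qed auto

text \<open>Here \<open>a\<close> and \<open>b\<close> are the net numbers of outer and inner steps,
  and the constants 0, 2, 1 count spokes from below: inner steps require a spoke to go in and
  another one to come back.\<close>

lemma walk_from_u:
  assumes "(u i, x) \<in> E ^^ l"
  shows "(\<exists>a. \<bar>a\<bar> \<le> int l \<and> x = u (i + a)) \<or>
    (\<exists>a b. \<bar>a\<bar> + \<bar>b\<bar> + 2 \<le> int l \<and> x = u (i + a + b * k)) \<or>
    (\<exists>a b. \<bar>a\<bar> + \<bar>b\<bar> + 1 \<le> int l \<and> x = v (i + a + b * k))"
    (is "?A l x \<or> ?B l x \<or> ?C l x")
  using assms
proof (induction l arbitrary: x)
  case 0
  then show ?case by (auto intro: exI[of _ 0])
next
  case (Suc l)
  then obtain z where z: "(u i, z) \<in> E ^^ l" "(z, x) \<in> E" by auto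
  from Suc.IH[OF z(1)] consider "?A l z" | "?B l z" | "?C l z" by blast
  then show ?case
  proof cases
    case 1
    then obtain a where a: "\<bar>a\<bar> \<le> int l" "z = u (i + a)" by blast
    \<comment> \<open>The summand \<open>0 * k\<close> puts the first spoke into the shape of the
      third alternative, with \<open>b = 0\<close>.\<close>
    from z(2) consider "x = u (i + (a + 1))" | "x = u (i + (a - 1))" | "x = v (i + a + 0 * k)"
      by (auto simp: a arc_u_iff algebra_simps)
    then show ?thesis
    proof cases
      case 1
      moreover have "\<bar>a + 1\<bar> \<le> int (Suc l)" using a by linarith
      ultimately show ?thesis by blast
    next
      case 2
      moreover have "\<bar>a - 1\<bar> \<le> int (Suc l)" using a by linarith
      ultimately show ?thesis by blast
    next
      case 3
      moreover have "\<bar>a\<bar> + \<bar>0\<bar> + 1 \<le> int (Suc l)" using a by linarith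
      ultimately show ?thesis by blast
    qed
  next
    case 2
    then obtain a b where a: "\<bar>a\<bar> + \<bar>b\<bar> + 2 \<le> int l" "z = u (i + a + b * k)" by blast
    from z(2) consider "x = u (i + (a + 1) + b * k)" | "x = u (i + (a - 1) + b * k)"
      | "x = v (i + a + b * k)"
      by (auto simp: a arc_u_iff algebra_simps)
    then show ?thesis
    proof cases
      case 1
      moreover have "\<bar>a + 1\<bar> + \<bar>b\<bar> + 2 \<le> int (Suc l)" using a by linarith
      ultimately show ?thesis by blast
    next
      case 2
      moreover have "\<bar>a - 1\<bar> + \<bar>b\<bar> + 2 \<le> int (Suc l)" using a by linarith
      ultimately show ?thesis by blast
    next
      case 3
      \<comment> \<open>This spoke is at least the third one; the bound is weakened to a single
        spoke.\<close>
      moreover have "\<bar>a\<bar> + \<bar>b\<bar> + 1 \<le> int (Suc l)" using a by linarith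
      ultimately show ?thesis by blast
    qed
  next
    case 3
    then obtain a b where a: "\<bar>a\<bar> + \<bar>b\<bar> + 1 \<le> int l" "z = v (i + a + b * k)" by blast
    from z(2) consider "x = v (i + a + (b + 1) * k)" | "x = v (i + a + (b - 1) * k)"
      | "x = u (i + a + b * k)"
      by (auto simp: a arc_v_iff algebra_simps)
    then show ?thesis
    proof cases
      case 1
      moreover have "\<bar>a\<bar> + \<bar>b + 1\<bar> + 1 \<le> int (Suc l)" using a by linarith
      ultimately show ?thesis by blast
    next
      case 2
      moreover have "\<bar>a\<bar> + \<bar>b - 1\<bar> + 1 \<le> int (Suc l)" using a by linarith
      ultimately show ?thesis by blast
    next
      case 3
      moreover have "\<bar>a\<bar> + \<bar>b\<bar> + 2 \<le> int (Suc l)" using a by linarith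
      ultimately show ?thesis by blast
    qed
  qed
qed

lemma pverts_cases:
  assumes "x \<in> pverts (GP n k)"
  obtains i where "x = u i" | i where "x = v i"
  using assms by (auto simp: pverts_GP)

lemma ex_relpow:
  assumes "x \<in> pverts (GP n k)" "y \<in> pverts (GP n k)"
  shows "\<exists>l. (x, y) \<in> E ^^ l"
proof -
  have "\<exists>l. (u 0, z) \<in> E ^^ l" if "z \<in> pverts (GP n k)" for z
    using that
  proof (cases z rule: pverts_cases)
    case (1 i)
    then show ?thesis using u_walk[of 0 i] by auto
  next
    case (2 i)
    then show ?thesis using u_v_walk[of 0 i 0] by (auto simp del: relpow.simps)
  qed
  then obtain l m where "(u 0, x) \<in> E ^^ l" "(u 0, y) \<in> E ^^ m" using assms by blast
  then have "(x, y) \<in> E ^^ (l + m)"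
    unfolding relpow_add using relpow_sym by blast
  then show ?thesis ..
qed

lemma connected_GP: "Digraph_Component.connected (with_proj (GP n k))"
  unfolding connected_def
proof (rule strongly_connectedI)
  have "u 0 \<in> pverts (GP n k)" by simp
  then show "verts (mk_symmetric (GP n k)) \<noteq> {}"
    unfolding with_proj_simps pverts_mk_symmetric by blast
next
  fix x y
  assume "x \<in> verts (mk_symmetric (GP n k))" "y \<in> verts (mk_symmetric (GP n k))"
  then have xy: "x \<in> pverts (GP n k)" "y \<in> pverts (GP n k)" by simp_all
  then obtain l where "(x, y) \<in> E ^^ l" using ex_relpow by blast
  then obtain p where "awalk x p y" using xy(1) awalk_iff_relpow by blast
  then have "x \<rightarrow>\<^sup>*\<^bsub>with_proj (GP n k)\<^esub> y" by (rule reachable_awalkI)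
  then show "x \<rightarrow>\<^sup>*\<^bsub>mk_symmetric (with_proj (GP n k))\<^esub> y" by (rule reachable_mk_symmetricI)
qed

lemma gdist_le_diam:
  assumes "x \<in> pverts (GP n k)" "y \<in> pverts (GP n k)"
  shows "gdist (with_proj (GP n k)) x y \<le> diam (with_proj (GP n k))"
proof -
  \<comment> \<open>As the image of a finite set, the set of distances is finite, so
    \<open>Max\<close> is an upper bound of it.\<close>
  have "{gdist (with_proj (GP n k)) x y |x y. x \<in> pverts (GP n k) \<and> y \<in> pverts (GP n k)} =
      (\<lambda>(x, y). gdist (with_proj (GP n k)) x y) ` (pverts (GP n k) \<times> pverts (GP n k))"
    by auto
  then show ?thesis
    unfolding diam_def using assms by (auto intro!: Max_ge)
qed

section \<open>Reflections of the index set\<close>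

definition mirror :: "int \<Rightarrow> gp_vertex \<Rightarrow> gp_vertex" where
  "mirror s x = (case x of U i \<Rightarrow> u (s - i) | V i \<Rightarrow> v (s - i))"

lemma mirror_u [simp]: "mirror s (u i) = u (s - i)"
  and mirror_v [simp]: "mirror s (v i) = v (s - i)"
  by (simp_all add: mirror_def u_def v_def mod_diff_right_eq)

text \<open>The reflection exchanges steps by 1 with steps by -1 and steps by \<open>k\<close> with
  steps by \<open>- k\<close>; it respects spokes because both cycles are reflected by the same
  map.\<close>

lemma card_W_mirror:
  assumes "x \<in> pverts (GP n k)" "mirror s x = y"
  shows "card (W (with_proj (GP n k)) x y) = card (W (with_proj (GP n k)) y x)"
proof (rule card_W_swap[of "mirror s"])
  fix x y assume "(x, y) \<in> E"
  moreover from this have "x \<in> pverts (GP n k)" by (rule in_arcsD1)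
  ultimately show "(mirror s x, mirror s y) \<in> E"
    by (elim pverts_cases) (auto simp: arc_u_iff arc_v_iff algebra_simps)
qed (use assms in \<open>auto elim!: pverts_cases\<close>)

section \<open>The word norm on residues and its relation to distances\<close>

definition nrm :: "int \<Rightarrow> nat" where
  "nrm j = (LEAST r. \<exists>a b. \<bar>a\<bar> + \<bar>b\<bar> = int r \<and> n dvd a + b * k - j)"

lemma nrm_witness: obtains a b where "\<bar>a\<bar> + \<bar>b\<bar> = int (nrm j)" "n dvd a + b * k - j"
proof -
  have "\<exists>a b. \<bar>a\<bar> + \<bar>b\<bar> = int (nrm j) \<and> n dvd a + b * k - j"
    unfolding nrm_def
    \<comment> \<open>The least element exists because \<open>j\<close> itself is represented by
      \<open>a = j\<close>, \<open>b = 0\<close>.\<close>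
    by (rule LeastI[of _ "nat \<bar>j\<bar>"], rule exI[of _ j], rule exI[of _ 0]) auto
  then show ?thesis using that by blast
qed

lemma nrm_le: "n dvd a + b * k - j \<Longrightarrow> int (nrm j) \<le> \<bar>a\<bar> + \<bar>b\<bar>"
proof -
  assume "n dvd a + b * k - j"
  then have "nrm j \<le> nat (\<bar>a\<bar> + \<bar>b\<bar>)"
    unfolding nrm_def by (intro Least_le) auto
  then show ?thesis by linarith
qed

lemma gdist_u_v_le: "gdist (with_proj (GP n k)) (u i) (v j) \<le> nrm (j - i) + 1"
  and gdist_v_u_le: "gdist (with_proj (GP n k)) (v j) (u i) \<le> nrm (j - i) + 1"
proof -
  obtain a b where ab: "\<bar>a\<bar> + \<bar>b\<bar> = int (nrm (j - i))" "n dvd a + b * k - (j - i)"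
    by (rule nrm_witness)
  then have "v j = v (i + a + b * k)"
    using dvd_diff_commute by (force simp: v_eq_iff algebra_simps)
  then have "(u i, v j) \<in> E ^^ (nrm (j - i) + 1)"
    using u_v_walk[of i a b] ab by simp
  then show "gdist (with_proj (GP n k)) (u i) (v j) \<le> nrm (j - i) + 1"
    "gdist (with_proj (GP n k)) (v j) (u i) \<le> nrm (j - i) + 1"
    by (auto intro: gdist_le_relpow relpow_sym simp del: relpow.simps)
qed

text \<open>A walk without spokes has a net displacement congruent to \<open>j\<close>, which
  \<open>far\<close> makes long. Any other walk pays two spokes on top of a word representing
  \<open>j\<close>.\<close>

lemma gdist_u_u_ge:
  assumes far: "\<And>a. n dvd a - j \<Longrightarrow> int (nrm j) + 2 \<le> \<bar>a\<bar>"
  shows "nrm j + 2 \<le> gdist (with_proj (GP n k)) (u 0) (u j)"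
proof -
  let ?d = "gdist (with_proj (GP n k)) (u 0) (u j)"
  have "(u 0, u j) \<in> E ^^ ?d"
    using ex_relpow[of "u 0" "u j"] relpow_gdist by auto
  from walk_from_u[OF this]
  consider a where "\<bar>a\<bar> \<le> int ?d" "n dvd j - a"
    | a b where "\<bar>a\<bar> + \<bar>b\<bar> + 2 \<le> int ?d" "n dvd j - (a + b * k)"
    by (auto simp: u_eq_iff u_neq_v)
  then show ?thesis
  proof cases
    case 1
    then show ?thesis using far[of a] by (simp add: dvd_diff_commute)
  next
    case 2
    then show ?thesis using nrm_le[of a b j] by (simp add: dvd_diff_commute)
  qed
qed

text \<open>Residues of norm less than \<open>m\<close> are images of the diamond of radius
  \<open>m - 1\<close>. For \<open>m = 0\<close> there are none, and the bound is 1.\<close>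

lemma card_nrm_less:
  "finite {j \<in> {0..<n}. nrm j < m} \<and> int (card {j \<in> {0..<n}. nrm j < m}) \<le> 2 * int m * (int m - 1) + 1"
proof (cases m)
  case (Suc r)
  let ?D = "{(a::int, b::int). \<bar>a\<bar> + \<bar>b\<bar> \<le> int r}"
  have "{j \<in> {0..<n}. nrm j < m} \<subseteq> (\<lambda>(a, b). (a + b * k) mod n) ` ?D"
  proof
    fix j assume j: "j \<in> {j \<in> {0..<n}. nrm j < m}"
    obtain a b where ab: "\<bar>a\<bar> + \<bar>b\<bar> = int (nrm j)" "n dvd a + b * k - j" by (rule nrm_witness)
    then have "(a + b * k) mod n = j" using j by (simp add: mod_eq_dvd_iff[symmetric])
    moreover have "(a, b) \<in> ?D" using ab(1) j Suc by auto
    ultimately show "j \<in> (\<lambda>(a, b). (a + b * k) mod n) ` ?D" by force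
  qed
  then have "card {j \<in> {0..<n}. nrm j < m} \<le> card ?D"
    using card_diamond_le[of r] by (meson surj_card_le)
  also have "\<dots> \<le> 2 * r * (r + 1) + 1" using card_diamond_le by blast
  finally have "int (card {j \<in> {0..<n}. nrm j < m}) \<le> int (2 * r * (r + 1) + 1)"
    by (simp only: of_nat_le_iff)
  moreover have "finite {j \<in> {0..<n}. nrm j < m}" by (rule finite_subset[of _ "{0..<n}"]) auto
  ultimately show ?thesis using Suc by (simp add: algebra_simps)
qed simp

section \<open>A residue of maximal norm far from 0\<close>

text \<open>
  If every residue of maximal norm \<open>m\<close> were \<open>a\<close> modulo \<open>n\<close> with \<open>\<bar>a\<bar> \<le> m + 1\<close>, the
  shortcut \<open>a = k + (a - k)\<close> would force \<open>2 * m \<le> k + 1\<close>, and then there are too few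
  residues of norm less than \<open>m\<close> to fill up all \<open>n\<close> of them.
\<close>

lemma ex_far_residue:
  assumes "k = 3 \<Longrightarrow> n \<ge> 8" "k = 4 \<Longrightarrow> n \<ge> 10"
    and "odd k \<Longrightarrow> k \<ge> 5 \<Longrightarrow> 2 * n \<ge> k * (k + 1)"
    and "even k \<Longrightarrow> k \<ge> 6 \<Longrightarrow> 2 * n \<ge> k\<^sup>2"
    and le: "\<And>j. nrm j \<le> m" and att: "nrm j0 = m"
  shows "\<exists>j. nrm j = m \<and> (\<forall>a. n dvd a - j \<longrightarrow> int m + 2 \<le> \<bar>a\<bar>)"
proof (rule ccontr)
  assume "\<not> ?thesis"
  then have near: "\<exists>a. n dvd a - j \<and> \<bar>a\<bar> \<le> int m + 1" if "nrm j = m" for j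
    using that by force
  have ends: "(\<bar>a\<bar> = int m \<and> 2 * int m \<le> k + 1) \<or> (\<bar>a\<bar> = int m + 1 \<and> 2 * int m \<le> k)"
    if a: "n dvd a - j" "\<bar>a\<bar> \<le> int m + 1" and j: "nrm j = m" for a j
  proof -
    \<comment> \<open>Three words for \<open>j\<close>: \<open>a\<close>, \<open>(a - k) + k\<close>
      and \<open>(a + k) - k\<close>. For \<open>0 \<le> a \<le> k\<close> the second gives
      \<open>m \<le> k - a + 1\<close>; for \<open>a > k\<close> it gives
      \<open>m \<le> a - k + 1 \<le> m + 2 - k\<close>, against \<open>k \<ge> 3\<close>. The third
      treats negative \<open>a\<close> likewise.\<close>
    have "int m \<le> \<bar>a\<bar>" using nrm_le[of a 0 j] a j by simp
    moreover have "int m \<le> \<bar>a - k\<bar> + 1" using nrm_le[of "a - k" 1 j] a j by simp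
    moreover have "int m \<le> \<bar>a + k\<bar> + 1" using nrm_le[of "a + k" "-1" j] a j by simp
    ultimately show ?thesis using a(2) k_ge by linarith
  qed
  have m_le: "2 * int m \<le> k + 1" using near[OF att] ends[OF _ _ att] by fastforce
  let ?S = "{j \<in> {0..<n}. nrm j < m}"
  have fin: "finite ?S" and card_S: "int (card ?S) \<le> 2 * int m * (int m - 1) + 1"
    using card_nrm_less by blast+
  have cover: "j \<in> ?S \<or> (\<exists>a. j = a mod n \<and> n dvd a - j \<and> \<bar>a\<bar> \<le> int m + 1 \<and> nrm j = m)"
    if j: "j \<in> {0..<n}" for j
  proof (cases "nrm j = m")
    case True
    then obtain a where "n dvd a - j" "\<bar>a\<bar> \<le> int m + 1" using near by blast
    moreover from this have "j = a mod n" using j by (simp add: mod_eq_dvd_iff[symmetric])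
    ultimately show ?thesis using True by blast
  qed (use j le[of j] in auto)
  have card_le: "n \<le> int (card ?S) + int (length xs)"
    if "{0..<n} \<subseteq> ?S \<union> (\<lambda>a. a mod n) ` set xs" for xs
  proof -
    have "card {0..<n} \<le> card (?S \<union> (\<lambda>a. a mod n) ` set xs)"
      using that fin by (intro card_mono) auto
    also have "\<dots> \<le> card ?S + card ((\<lambda>a. a mod n) ` set xs)" by (rule card_Un_le)
    also have "card ((\<lambda>a. a mod n) ` set xs) \<le> length xs"
      using card_image_le[of "set xs" "\<lambda>a. a mod n"] card_length[of xs] by simp
    finally show ?thesis using n_gt k_ge by simp
  qed
  show False
  proof (cases "2 * int m \<le> k")
    case True
    \<comment> \<open>All four values of \<open>a\<close> allowed by \<open>ends\<close> remain
      possible here, so at most four residues have norm \<open>m\<close>.\<close>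
    have "{0..<n} \<subseteq> ?S \<union> (\<lambda>a. a mod n) ` set [int m, - int m, int m + 1, - int m - 1]"
    proof
      fix j assume "j \<in> {0..<n}"
      from cover[OF this] show "j \<in> ?S \<union> (\<lambda>a. a mod n) ` set [int m, - int m, int m + 1, - int m - 1]"
      proof
        assume "\<exists>a. j = a mod n \<and> n dvd a - j \<and> \<bar>a\<bar> \<le> int m + 1 \<and> nrm j = m"
        then obtain a where a: "j = a mod n" "n dvd a - j" "\<bar>a\<bar> \<le> int m + 1" "nrm j = m" by blast
        from ends[OF a(2-4)]
        have "a \<in> set [int m, - int m, int m + 1, - int m - 1]" by auto
        then show ?thesis using a(1) by blast
      qed blast
    qed
    from card_le[OF this] card_S have n_le: "n \<le> 2 * int m * (int m - 1) + 5" by simp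
    \<comment> \<open>The square enters through 4m(m - 1) + 1 = (2m - 1)^2.\<close>
    have "(2 * int m - 1)\<^sup>2 \<le> (k - 1)\<^sup>2"
      using True k_ge by (subst abs_le_square_iff[symmetric]) auto
    then have n2: "2 * n \<le> k\<^sup>2 - 2 * k + 10"
      using n_le by (simp add: algebra_simps power2_eq_square)
    \<comment> \<open>For \<open>k\<close> = 3, 4, 5 the bound \<open>n2\<close> forces
      \<open>n\<close> to be at most 6, 9, 12, against the assumed 8, 10, 15. From
      \<open>k = 6\<close> on, \<open>2 * k > 10\<close> pushes it below
      \<open>k\<^sup>2\<close>.\<close>
    consider "k = 3" | "k = 4" | "k = 5" | "k \<ge> 6" "even k" | "k \<ge> 6" "odd k" using k_ge by linarith
    then show False
    proof cases
      case 5
      then have "2 * n \<ge> k\<^sup>2 + k" using assms(3) by (simp add: algebra_simps power2_eq_square)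
      then show False using n2 5 by linarith
    qed (use n2 assms in auto)
  next
    case False
    \<comment> \<open>In this extremal case \<open>ends\<close> leaves only \<open>m\<close> and
      \<open>- m\<close>, so at most two residues have norm \<open>m\<close>.\<close>
    then have k: "k = 2 * int m - 1" using m_le by linarith
    have ends': "a = int m \<or> a = - int m"
      if "n dvd a - j" "\<bar>a\<bar> \<le> int m + 1" "nrm j = m" for a j
      using ends[OF that] False by auto
    have "{0..<n} \<subseteq> ?S \<union> (\<lambda>a. a mod n) ` set [int m, - int m]"
      using cover ends' by fastforce
    from card_le[OF this] card_S have "n \<le> 2 * int m * (int m - 1) + 3" by simp
    then have n2: "2 * n \<le> k\<^sup>2 + 5" by (simp add: k algebra_simps power2_eq_square)
    have odd: "odd k" using k by simp
    have "k \<noteq> 4" using odd by auto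
    then consider "k = 3" | "k = 5" | "k \<ge> 6" using k_ge by linarith
    then show False
    proof cases
      case 1
      then show ?thesis using n2 assms by auto
    next
      \<comment> \<open>The count is tight for \<open>n = 15\<close>, \<open>k = 5\<close>; there \<open>7\<close> is far from \<open>0\<close> and has norm \<open>3\<close>.\<close>
      case 2
      then have n: "n = 15" and m: "m = 3" using n2 assms(3) k by auto
      obtain a b where ab: "\<bar>a\<bar> + \<bar>b\<bar> = int (nrm 7)" "n dvd a + b * k - 7" by (rule nrm_witness)
      \<comment> \<open>If \<bar>a\<bar> + \<bar>b\<bar> \<le> 2, then a + 5b = 7 modulo 15 forces a
        = 2 modulo 5, so a = 2 and b = 0; but 15 does not divide 2 - 7.\<close>
      have "\<not> nrm 7 < 3"
      proof
        assume "nrm 7 < 3"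
        then have "\<bar>a\<bar> + \<bar>b\<bar> \<le> 2" using ab by linarith
        moreover from this have "b = -2 \<or> b = -1 \<or> b = 0 \<or> b = 1 \<or> b = 2" by linarith
        ultimately show False using ab(2) n 2 by auto presburger+
      qed
      then have "nrm 7 = m" using le[of 7] m by simp
      \<comment> \<open>By \<open>ends'\<close>, 7 would be congruent to 3 or -3 modulo 15.\<close>
      then show False using near[of 7] ends'[of _ 7] n m by fastforce
    next
      case 3
      then have "2 * n \<ge> k\<^sup>2 + k" using assms(3) odd by (simp add: algebra_simps power2_eq_square)
      then show False using n2 3 by linarith
    qed
  qed
qed

text \<open>The norm takes finitely many values: \<open>j mod n\<close> unit steps represent
  \<open>j\<close>.\<close>

lemma ex_max_nrm: "\<exists>m j0. nrm j0 = m \<and> (\<forall>j. nrm j \<le> m)"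
proof -
  have bound: "nrm j \<le> nat n" for j
  proof -
    have "n dvd j mod n + 0 * k - j" by (simp add: mod_eq_dvd_iff[symmetric])
    from nrm_le[OF this] have "int (nrm j) \<le> j mod n" using n_gt k_ge by simp
    also have "\<dots> < n" using n_gt k_ge by simp
    finally show ?thesis by simp
  qed
  then have "finite (range nrm)" by (auto intro: finite_subset[of _ "{..nat n}"])
  then have "Max (range nrm) \<in> range nrm" "\<forall>j. nrm j \<le> Max (range nrm)"
    by auto
  then show ?thesis by (metis imageE)
qed

end

theorem theorem1p3:
  fixes n k :: int
  assumes "3 \<le> k" and "real_of_int k < real_of_int n / 2"
    and "k = 3 \<Longrightarrow> n \<ge> 8"
    and "k = 4 \<Longrightarrow> n \<ge> 10"
    and "odd k \<Longrightarrow> k \<ge> 5 \<Longrightarrow> real_of_int n \<ge> real_of_int k * (real_of_int k + 1) / 2"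
    and "even k \<Longrightarrow> k \<ge> 6 \<Longrightarrow> real_of_int n \<ge> real_of_int k ^ 2 / 2"
  shows "distance_balanced (diam (with_proj (GP n k))) (with_proj (GP n k))"
proof -
  interpret generalized_petersen n k
    using assms(1,2) by unfold_locales linarith+
  have odd: "2 * n \<ge> k * (k + 1)" if "odd k" "k \<ge> 5"
  proof -
    have "real_of_int (k * (k + 1)) \<le> real_of_int (2 * n)" using assms(5)[OF that] by simp
    then show ?thesis by (simp only: of_int_le_iff)
  qed
  have even: "2 * n \<ge> k\<^sup>2" if "even k" "k \<ge> 6"
  proof -
    have "real_of_int (k\<^sup>2) \<le> real_of_int (2 * n)" using assms(6)[OF that] by simp
    then show ?thesis by (simp only: of_int_le_iff)
  qed
  obtain m j0 where m: "nrm j0 = m" "\<And>j. nrm j \<le> m" using ex_max_nrm by blast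
  obtain j where "nrm j = m" "\<And>a. n dvd a - j \<Longrightarrow> int m + 2 \<le> \<bar>a\<bar>"
    using ex_far_residue[OF assms(3,4) odd even m(2,1)] by blast
  then have "m + 2 \<le> gdist (with_proj (GP n k)) (u 0) (u j)" using gdist_u_u_ge by blast
  then have diam: "m + 2 \<le> diam (with_proj (GP n k))"
    using gdist_le_diam[of "u 0" "u j"] by simp
  \<comment> \<open>A mixed pair needs at most \<open>m + 1\<close> steps, one short of the lower
    bound for the diameter.\<close>
  have less: "gdist (with_proj (GP n k)) (u i) (v j) < diam (with_proj (GP n k))"
    "gdist (with_proj (GP n k)) (v j) (u i) < diam (with_proj (GP n k))" for i j
    using gdist_u_v_le[of i j] gdist_v_u_le[of j i] m(2)[of "j - i"] diam by linarith+
  have "card (W (with_proj (GP n k)) x y) = card (W (with_proj (GP n k)) y x)"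
    if x: "x \<in> pverts (GP n k)" and y: "y \<in> pverts (GP n k)"
      and d: "gdist (with_proj (GP n k)) x y = diam (with_proj (GP n k))" for x y
  proof -
    from x y d less consider i j where "x = u i" "y = u j" | i j where "x = v i" "y = v j"
      by (metis pverts_cases less_irrefl)
    then show ?thesis
    proof cases
      case (1 i j)
      \<comment> \<open>The reflection with \<open>s = i + j\<close> sends the index
        \<open>i\<close> to \<open>j\<close>.\<close>
      then show ?thesis using card_W_mirror[OF x, of "i + j"] by simp
    next
      case (2 i j)
      then show ?thesis using card_W_mirror[OF x, of "i + j"] by simp
    qed
  qed
  \<comment> \<open>The fact \<open>diam\<close> also yields that the diameter is at least 1, as the
    predicate demands.\<close>
  then show ?thesis
    using connected_GP diam by (auto simp: distance_balanced_def)
qed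

end
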